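(* Let $\beta>0$, let $\theta\in\Theta$ be fixed, and let $W^\star := W^\star(\theta)=\arg\min_{W\in\mathbb{R}^{o\times d}}\mathcal{L}(W,\theta)$. Then $$\nabla_\theta \mathcal{L}^\star(\theta) = \nabla_\theta \mathcal{L}(W^\star,\theta),$$ where on the right-hand side $\nabla_\theta\mathcal{L}(W^\star,\theta)$ denotes the partial gradient of $\mathcal{L}$ with respect to its second argument, evaluated at $(W^\star,\theta)$ with the matrix $W^\star$ held fixed, and on the left-hand side the dependence of $W^\star(\theta)$ on $\theta$ is included in the differentiation.
   Context: Let $\mathcal{X}$ be a set, $\Theta\subset\mathbb{R}^N$ an open parameter set, and for each $\theta\in\Theta$ let $\phi_\theta:\mathcal{X}\to\mathbb{R}^d$ be a feature map such that $\theta\mapsto\phi_\theta(x)$ is differentiable for each $x\in\mathcal{X}$. Let $(x_i,y_i)$, $i=1,\dots,n$, be data with $x_i\in\mathcal{X}$, $y_i\in\mathbb{R}^o$. Write $X=(x_1,\dots,x_n)$, $Y=(y_1,\dots,y_n)\in\mathbb{R}^{o\times n}$, and let $\phi_\theta(X)\in\mathbb{R}^{d\times n}$ be the matrix with columns $\phi_\theta(x_i)$. For $W\in\mathbb{R}^{o\times d}$ define $$\mathcal{L}(W,\theta)=\sum_{i=1}^n\|y_i-W\phi_\theta(x_i)\|_2^2+\beta\|W\|_F^2,$$ where $\|\cdot\|_F$ is the Frobenius norm. For $\beta>0$ the minimizer over $W$ is unique and equals $W^\star(\theta)=Y\phi_\theta(X)^\top(\phi_\theta(X)\phi_\theta(X)^\top+\beta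 I)^{-1}$. Define $\mathcal{L}^\star(\theta):=\mathcal{L}(W^\star(\theta),\theta)$. *)

theory Defs
  imports "HOL-Analysis.Analysis"
begin

text \<open>The dimensions \<open>N, d, o, n\<close> are finite index types; \<^typ>\<open>real^'d^'o\<close> is the type of
  matrices with rows indexed by \<open>'o\<close> and columns by \<open>'d\<close>.\<close>

definition frobenius_norm :: "real^'d^'o \<Rightarrow> real" where
  "frobenius_norm A = sqrt (\<Sum>i\<in>UNIV. \<Sum>j\<in>UNIV. (A $ i $ j)\<^sup>2)"

definition loss ::
  "(real^'N \<Rightarrow> 'x \<Rightarrow> real^'d) \<Rightarrow> ('n::finite \<Rightarrow> 'x) \<Rightarrow> ('n \<Rightarrow> real^'o) \<Rightarrow> real
    \<Rightarrow> real^'d^'o \<Rightarrow> real^'N \<Rightarrow> real" where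
  "loss \<phi> x y \<beta> W \<theta> =
     (\<Sum>i\<in>UNIV. (norm (y i - W *v \<phi> \<theta> (x i)))\<^sup>2) + \<beta> * (frobenius_norm W)\<^sup>2"

text \<open>For \<open>\<beta> > 0\<close> this is the unique minimizer of \<open>\<lambda>W. loss \<phi> x y \<beta> W \<theta>\<close>, and it has the usual
  closed form; see \<open>W_star_unique_minimizer\<close> and \<open>W_star_closed_form\<close> below.\<close>

definition W_star ::
  "(real^'N \<Rightarrow> 'x \<Rightarrow> real^'d) \<Rightarrow> ('n::finite \<Rightarrow> 'x) \<Rightarrow> ('n \<Rightarrow> real^'o) \<Rightarrow> real
    \<Rightarrow> real^'N \<Rightarrow> real^'d^'o" where
  "W_star \<phi> x y \<beta> \<theta> = (ARG_MIN (\<lambda>W. loss \<phi> x y \<beta> W \<theta>) W. True)"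

definition loss_star ::
  "(real^'N \<Rightarrow> 'x \<Rightarrow> real^'d) \<Rightarrow> ('n::finite \<Rightarrow> 'x) \<Rightarrow> ('n \<Rightarrow> real^'o) \<Rightarrow> real
    \<Rightarrow> real^'N \<Rightarrow> real" where
  "loss_star \<phi> x y \<beta> \<theta> = loss \<phi> x y \<beta> (W_star \<phi> x y \<beta> \<theta>) \<theta>"

definition matrix_of_columns :: "('n::finite \<Rightarrow> real^'m) \<Rightarrow> real^'n^'m" where
  "matrix_of_columns v = (\<chi> k i. v i $ k)"

definition ridge_solution ::
  "(real^'N \<Rightarrow> 'x \<Rightarrow> real^'d) \<Rightarrow> ('n::finite \<Rightarrow> 'x) \<Rightarrow> ('n \<Rightarrow> real^'o) \<Rightarrow> real
    \<Rightarrow> real^'N \<Rightarrow> real^'d^'o" where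
  "ridge_solution \<phi> x y \<beta> \<theta> =
     (let \<Phi> = matrix_of_columns (\<lambda>i. \<phi> \<theta> (x i)); Y = matrix_of_columns y
      in Y ** transpose \<Phi> ** matrix_inv (\<Phi> ** transpose \<Phi> + \<beta> *\<^sub>R mat 1))"

lemma frobenius_norm_eq_norm: "frobenius_norm A = norm A"
  by (simp add: frobenius_norm_def norm_vec_def L2_set_def sum_nonneg)

lemma sum_inner_matrix_of_columns:
  fixes V :: "real^'d^'o"
  shows "(\<Sum>i\<in>UNIV. z i \<bullet> (V *v p i)) =
    (matrix_of_columns z ** transpose (matrix_of_columns p)) \<bullet> V"
proof -
  have "(\<Sum>i\<in>UNIV. z i \<bullet> (V *v p i)) =
      (\<Sum>i\<in>UNIV. \<Sum>a\<in>UNIV. \<Sum>k\<in>UNIV. z i $ a * p i $ k * V $ a $ k)"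
    by (simp add: inner_vec_def matrix_vector_mult_def sum_distrib_left mult_ac)
  also have "\<dots> = (\<Sum>a\<in>UNIV. \<Sum>i\<in>UNIV. \<Sum>k\<in>UNIV. z i $ a * p i $ k * V $ a $ k)"
    by (rule sum.swap)
  also have "\<dots> = (\<Sum>a\<in>UNIV. \<Sum>k\<in>UNIV. \<Sum>i\<in>UNIV. z i $ a * p i $ k * V $ a $ k)"
    by (rule sum.cong[OF refl]) (rule sum.swap)
  also have "\<dots> = (matrix_of_columns z ** transpose (matrix_of_columns p)) \<bullet> V"
    by (simp add: inner_vec_def matrix_matrix_mult_def matrix_of_columns_def transpose_def
        sum_distrib_right)
  finally show ?thesis .
qed

lemma matrix_mult_matrix_of_columns:
  "W ** matrix_of_columns p = matrix_of_columns (\<lambda>i. W *v p i)"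
  by (simp add: matrix_of_columns_def matrix_matrix_mult_def matrix_vector_mult_def vec_eq_iff)

lemma invertible_gram_plus_ridge:
  fixes \<Phi> :: "real^'n^'d"
  assumes "\<beta> > 0"
  shows "invertible (\<Phi> ** transpose \<Phi> + \<beta> *\<^sub>R mat 1)"
proof -
  have "v = 0" if "(\<Phi> ** transpose \<Phi> + \<beta> *\<^sub>R mat 1) *v v = 0" for v
  proof -
    have "0 = ((\<Phi> ** transpose \<Phi> + \<beta> *\<^sub>R mat 1) *v v) \<bullet> v"
      using that by simp
    also have "\<dots> = (\<Phi> *v (transpose \<Phi> *v v)) \<bullet> v + \<beta> * (v \<bullet> v)"
      by (simp add: matrix_vector_mult_add_rdistrib inner_add_left
          matrix_vector_mul_assoc[symmetric] scaleR_matrix_vector_assoc[symmetric])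
    also have "(\<Phi> *v (transpose \<Phi> *v v)) \<bullet> v = (transpose \<Phi> *v v) \<bullet> (transpose \<Phi> *v v)"
      by (metis dot_lmul_matrix inner_commute transpose_matrix_vector)
    finally have "\<beta> * (v \<bullet> v) \<le> 0"
      by (smt (verit) inner_ge_zero)
    then show "v = 0"
      using assms by (metis inner_gt_zero_iff mult_pos_pos not_less)
  qed
  then show ?thesis
    by (simp add: invertible_left_inverse matrix_left_invertible_ker)
qed

lemma loss_ridge_expansion:
  fixes W :: "real^'d^'o" and \<phi> :: "real^'N \<Rightarrow> 'x \<Rightarrow> real^'d" and \<theta> :: "real^'N"
    and x :: "'n::finite \<Rightarrow> 'x" and y :: "'n \<Rightarrow> real^'o"
  assumes "\<beta> > 0"
  defines "R \<equiv> ridge_solution \<phi> x y \<beta> \<theta>"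
  shows "loss \<phi> x y \<beta> W \<theta> = loss \<phi> x y \<beta> R \<theta>
    + (\<Sum>i\<in>UNIV. (norm ((W - R) *v \<phi> \<theta> (x i)))\<^sup>2) + \<beta> * (norm (W - R))\<^sup>2"
proof -
  define p where "p = (\<lambda>i. \<phi> \<theta> (x i))"
  define \<Phi> where "\<Phi> = matrix_of_columns p"
  define Y where "Y = matrix_of_columns y"
  define V where "V = W - R"
  let ?A = "\<Phi> ** transpose \<Phi> + \<beta> *\<^sub>R mat 1"
  have "R = Y ** transpose \<Phi> ** matrix_inv ?A"
    by (simp add: R_def ridge_solution_def Let_def \<Phi>_def Y_def p_def)
  moreover have "matrix_inv ?A ** ?A = mat 1"
    using someI_ex[OF invertible_gram_plus_ridge[OF assms(1), of \<Phi>, unfolded invertible_def]]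
    by (simp add: matrix_inv_def)
  ultimately have "R ** ?A = Y ** transpose \<Phi>"
    by (metis matrix_mul_assoc matrix_mul_rid)
  then have normal: "Y ** transpose \<Phi> = R ** \<Phi> ** transpose \<Phi> + \<beta> *\<^sub>R R"
    by (simp add: matrix_add_ldistrib matrix_mul_assoc matrix_scalar_ac
        flip: scalar_matrix_assoc)
  have "(\<Sum>i\<in>UNIV. y i \<bullet> (V *v p i)) = (Y ** transpose \<Phi>) \<bullet> V"
    by (simp add: sum_inner_matrix_of_columns Y_def \<Phi>_def)
  moreover have "(\<Sum>i\<in>UNIV. (R *v p i) \<bullet> (V *v p i)) = (R ** \<Phi> ** transpose \<Phi>) \<bullet> V"
    by (simp add: sum_inner_matrix_of_columns \<Phi>_def matrix_mult_matrix_of_columns)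
  ultimately have cross: "(\<Sum>i\<in>UNIV. (y i - R *v p i) \<bullet> (V *v p i)) = \<beta> * (R \<bullet> V)"
    by (simp add: normal inner_diff_left sum_subtractf inner_add_left)
  have W: "W = R + V"
    by (simp add: V_def)
  have "(norm (y i - W *v p i))\<^sup>2 = (norm (y i - R *v p i))\<^sup>2
      - 2 * ((y i - R *v p i) \<bullet> (V *v p i)) + (norm (V *v p i))\<^sup>2" for i
    unfolding W matrix_vector_mult_add_rdistrib power2_norm_eq_inner
    by (simp add: algebra_simps inner_commute)
  then have "(\<Sum>i\<in>UNIV. (norm (y i - W *v p i))\<^sup>2) = (\<Sum>i\<in>UNIV. (norm (y i - R *v p i))\<^sup>2)
      - 2 * (\<beta> * (R \<bullet> V)) + (\<Sum>i\<in>UNIV. (norm (V *v p i))\<^sup>2)"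
    by (simp add: sum.distrib sum_subtractf flip: sum_distrib_left cross)
  moreover have "(norm W)\<^sup>2 = (norm R)\<^sup>2 + 2 * (R \<bullet> V) + (norm V)\<^sup>2"
    unfolding W power2_norm_eq_inner by (simp add: algebra_simps inner_commute)
  ultimately show ?thesis
    by (simp add: loss_def frobenius_norm_eq_norm p_def algebra_simps flip: V_def)
qed

lemma loss_ridge_less:
  assumes "\<beta> > 0" "W \<noteq> ridge_solution \<phi> x y \<beta> \<theta>"
  shows "loss \<phi> x y \<beta> (ridge_solution \<phi> x y \<beta> \<theta>) \<theta> < loss \<phi> x y \<beta> W \<theta>"
proof -
  let ?R = "ridge_solution \<phi> x y \<beta> \<theta>"
  have "0 < \<beta> * (norm (W - ?R))\<^sup>2"
    using assms by simp
  moreover have "0 \<le> (\<Sum>i\<in>UNIV. (norm ((W - ?R) *v \<phi> \<theta> (x i)))\<^sup>2)"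
    by (simp add: sum_nonneg)
  ultimately show ?thesis
    using loss_ridge_expansion[OF assms(1), of \<phi> x y W \<theta>] by linarith
qed

lemma W_star_closed_form:
  fixes \<phi> :: "real^'N \<Rightarrow> 'x \<Rightarrow> real^'d" and y :: "'n::finite \<Rightarrow> real^'o"
  assumes "\<beta> > 0"
  shows "W_star \<phi> x y \<beta> \<theta> = ridge_solution \<phi> x y \<beta> \<theta>"
  unfolding W_star_def
proof (rule arg_minI)
  fix W
  show "\<not> loss \<phi> x y \<beta> W \<theta> < loss \<phi> x y \<beta> (ridge_solution \<phi> x y \<beta> \<theta>) \<theta>"
    using loss_ridge_less[OF assms, of W \<phi> x y \<theta>] by fastforce
next
  fix W :: "real^'d^'o"
  assume "\<forall>V. True \<longrightarrow> \<not> loss \<phi> x y \<beta> V \<theta> < loss \<phi> x y \<beta> W \<theta>"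
  then show "W = ridge_solution \<phi> x y \<beta> \<theta>"
    using loss_ridge_less[OF assms, of W \<phi> x y \<theta>] by blast
qed simp

lemma W_star_unique_minimizer:
  assumes "\<beta> > 0" "W \<noteq> W_star \<phi> x y \<beta> \<theta>"
  shows "loss \<phi> x y \<beta> (W_star \<phi> x y \<beta> \<theta>) \<theta> < loss \<phi> x y \<beta> W \<theta>"
  using assms loss_ridge_less by (simp add: W_star_closed_form)

end

theory Submission
  imports Defs
begin

text \<open>Write \<open>G(t)\<close> for half the gradient of the loss in \<open>W\<close> at the fixed matrix
  \<open>W\<^sup>\<star>(\<theta>)\<close> and at the parameter \<open>t\<close>. Strong convexity of the ridge problem bounds the
  gap \<open>\<L>(W\<^sup>\<star>(\<theta>), t) - \<L>\<^sup>\<star>(t)\<close> between \<open>0\<close> and \<open>\<parallel>G(t)\<parallel>\<^sup>2 / \<beta>\<close>. Since \<open>G\<close> is differentiable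
  with \<open>G(\<theta>) = 0\<close>, the gap vanishes to first order at \<open>\<theta>\<close>, so both functions have the same
  gradient there; differentiability of \<open>W\<^sup>\<star>\<close> itself never enters.\<close>

text \<open>The matrix u v^T, kept as a bilinear map so that the product rule applies to it
  directly.\<close>

definition outer_product :: "real^'o \<Rightarrow> real^'d \<Rightarrow> real^'d^'o" where
  "outer_product u v = (\<chi> k. u $ k *\<^sub>R v)"

lemma inner_outer_product:
  fixes V :: "real^'d^'o"
  shows "outer_product u v \<bullet> V = u \<bullet> (V *v v)"
  by (simp add: outer_product_def inner_vec_def matrix_vector_mult_def sum_distrib_left mult_ac)

lemma bounded_bilinear_outer_product:
  "bounded_bilinear (outer_product :: real^'o \<Rightarrow> real^'d \<Rightarrow> real^'d^'o)"
  unfolding bilinear_conv_bounded_bilinear[symmetric] bilinear_def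
  by (auto intro!: linearI simp: outer_product_def vec_eq_iff algebra_simps)

definition half_gradient ::
  "(real^'N \<Rightarrow> 'x \<Rightarrow> real^'d) \<Rightarrow> ('n::finite \<Rightarrow> 'x) \<Rightarrow> ('n \<Rightarrow> real^'o) \<Rightarrow> real
    \<Rightarrow> real^'d^'o \<Rightarrow> real^'N \<Rightarrow> real^'d^'o" where
  "half_gradient \<phi> x y \<beta> W \<theta> =
     \<beta> *\<^sub>R W - (\<Sum>i\<in>UNIV. outer_product (y i - W *v \<phi> \<theta> (x i)) (\<phi> \<theta> (x i)))"

text \<open>The loss is quadratic in the matrix, so its second-order expansion is exact. The base
  point \<open>W\<close> is arbitrary, which allows expanding away from the minimizer.\<close>

lemma loss_add:
  "loss \<phi> x y \<beta> (W + V) \<theta> = loss \<phi> x y \<beta> W \<theta> + 2 * (half_gradient \<phi> x y \<beta> W \<theta> \<bullet> V)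
    + (\<Sum>i\<in>UNIV. (norm (V *v \<phi> \<theta> (x i)))\<^sup>2) + \<beta> * (norm V)\<^sup>2"
proof -
  define p where "p = (\<lambda>i. \<phi> \<theta> (x i))"
  have "(norm (y i - (W + V) *v p i))\<^sup>2 = (norm (y i - W *v p i))\<^sup>2
      - 2 * ((y i - W *v p i) \<bullet> (V *v p i)) + (norm (V *v p i))\<^sup>2" for i
    unfolding matrix_vector_mult_add_rdistrib power2_norm_eq_inner
    by (simp add: algebra_simps inner_commute)
  then have "(\<Sum>i\<in>UNIV. (norm (y i - (W + V) *v p i))\<^sup>2) = (\<Sum>i\<in>UNIV. (norm (y i - W *v p i))\<^sup>2)
      - 2 * (\<Sum>i\<in>UNIV. (y i - W *v p i) \<bullet> (V *v p i)) + (\<Sum>i\<in>UNIV. (norm (V *v p i))\<^sup>2)"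
    by (simp add: sum.distrib sum_subtractf sum_distrib_left)
  moreover have "(norm (W + V))\<^sup>2 = (norm W)\<^sup>2 + 2 * (W \<bullet> V) + (norm V)\<^sup>2"
    unfolding power2_norm_eq_inner by (simp add: algebra_simps inner_commute)
  ultimately show ?thesis
    unfolding loss_def frobenius_norm_eq_norm half_gradient_def inner_diff_left[of "_ *\<^sub>R _"]
      inner_sum_left inner_outer_product p_def
    by (simp add: distrib_left)
qed

text \<open>\<open>loss_ridge_expansion\<close> has no linear term at the minimizer. Comparing it
  with \<open>loss_add\<close> for the increment \<open>?G\<close> leaves only
  \<open>?G \<bullet> ?G = 0\<close>.\<close>

lemma half_gradient_W_star:
  assumes "\<beta> > 0"
  shows "half_gradient \<phi> x y \<beta> (W_star \<phi> x y \<beta> \<theta>) \<theta> = 0"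
proof -
  let ?R = "W_star \<phi> x y \<beta> \<theta>" and ?G = "half_gradient \<phi> x y \<beta> (W_star \<phi> x y \<beta> \<theta>) \<theta>"
  have "?G \<bullet> ?G = 0"
    using loss_ridge_expansion[OF assms, of \<phi> x y "?R + ?G" \<theta>] loss_add[of \<phi> x y \<beta> ?R ?G \<theta>]
    by (simp add: W_star_closed_form[OF assms])
  then show ?thesis
    by simp
qed

text \<open>The gap is expanded from both ends of the segment joining \<open>W\<close> to the
  minimizer. Together the expansions give gap = G . D, while the ridge term gives
  \<open>\<beta>\<close> |D|^2 <= gap, hence |D| <= |G| / \<open>\<beta>\<close>.\<close>

lemma loss_gap_bounds:
  assumes "\<beta> > 0"
  shows "0 \<le> loss \<phi> x y \<beta> W \<theta> - loss_star \<phi> x y \<beta> \<theta>"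
    and "loss \<phi> x y \<beta> W \<theta> - loss_star \<phi> x y \<beta> \<theta> \<le> (norm (half_gradient \<phi> x y \<beta> W \<theta>))\<^sup>2 / \<beta>"
proof -
  let ?gap = "loss \<phi> x y \<beta> W \<theta> - loss_star \<phi> x y \<beta> \<theta>"
  let ?G = "half_gradient \<phi> x y \<beta> W \<theta>"
  define D where "D = W - W_star \<phi> x y \<beta> \<theta>"
  have W_star: "W_star \<phi> x y \<beta> \<theta> = W + - D"
    by (simp add: D_def)
  define S where "S = (\<Sum>i\<in>UNIV. (norm (D *v \<phi> \<theta> (x i)))\<^sup>2)"
  have S: "S \<ge> 0"
    by (simp add: S_def sum_nonneg)
  have gap: "?gap = S + \<beta> * (norm D)\<^sup>2"
    using loss_ridge_expansion[OF assms, of \<phi> x y W \<theta>]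
    by (simp add: loss_star_def D_def S_def W_star_closed_form[OF assms])
  \<comment> \<open>The quadratic part is even in \<open>D\<close>, so both expansions share the
    same \<open>S\<close>.\<close>
  have "norm (- D *v v) = norm (D *v v)" for v
    by (metis mult_minus1 norm_minus_cancel scaleR_matrix_vector_assoc scaleR_minus1_left)
  then have "?gap = 2 * (?G \<bullet> D) - (S + \<beta> * (norm D)\<^sup>2)"
    using loss_add[of \<phi> x y \<beta> W "- D" \<theta>] W_star by (simp add: loss_star_def S_def)
  \<comment> \<open>Averaging the two formulas for the gap cancels the quadratic part.\<close>
  then have gap_inner: "?gap = ?G \<bullet> D"
    using gap by linarith
  show "0 \<le> ?gap"
    using gap S assms by simp
  have le: "?gap \<le> norm ?G * norm D"
    unfolding gap_inner by (rule norm_cauchy_schwarz)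
  then have "(\<beta> * norm D) * norm D \<le> norm ?G * norm D"
    using gap S by (simp add: power2_eq_square)
  then have "\<beta> * norm D \<le> norm ?G"
    by (cases "D = 0") auto
  then have "norm ?G * norm D \<le> norm ?G * (norm ?G / \<beta>)"
    using assms by (intro mult_left_mono) (auto simp: field_simps)
  with le show "?gap \<le> (norm ?G)\<^sup>2 / \<beta>"
    by (simp add: power2_eq_square)
qed

lemma differentiable_half_gradient:
  assumes "\<And>i. (\<lambda>t. \<phi> t (x i)) differentiable (at \<theta>)"
  shows "half_gradient \<phi> x y \<beta> W differentiable (at \<theta>)"
proof -
  obtain \<phi>' where \<phi>': "\<And>i. ((\<lambda>t. \<phi> t (x i)) has_derivative \<phi>' i) (at \<theta>)"
    using assms unfolding differentiable_def by metis
  show ?thesis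
    unfolding half_gradient_def[abs_def] differentiable_def
    \<comment> \<open>In the parameter this is a constant minus a finite sum of outer products of a
      residual, affine in the features, with the features themselves.\<close>
    by (rule exI, rule has_derivative_diff[OF has_derivative_const has_derivative_sum],
      rule bounded_bilinear.FDERIV[OF bounded_bilinear_outer_product
        has_derivative_diff[OF has_derivative_const
          bounded_linear.has_derivative[OF matrix_vector_mul_bounded_linear \<phi>']] \<phi>'])
qed

lemma differentiable_loss:
  assumes "\<And>i. (\<lambda>t. \<phi> t (x i)) differentiable (at \<theta>)"
  shows "loss \<phi> x y \<beta> W differentiable (at \<theta>)"
proof -
  obtain \<phi>' where \<phi>': "\<And>i. ((\<lambda>t. \<phi> t (x i)) has_derivative \<phi>' i) (at \<theta>)"
    using assms unfolding differentiable_def by metis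
  show ?thesis
    unfolding loss_def[abs_def] power2_norm_eq_inner differentiable_def
    by (rule exI, rule has_derivative_add[OF has_derivative_sum has_derivative_const],
      rule has_derivative_inner; rule has_derivative_diff[OF has_derivative_const
        bounded_linear.has_derivative[OF matrix_vector_mul_bounded_linear \<phi>']])
qed

text \<open>The bounds force \<open>f a = 0\<close> and |f| <= |g|, so the difference quotients of
  \<open>f\<close> at \<open>a\<close> are dominated by those of \<open>g\<close>.\<close>

lemma has_derivative_zero_squeeze:
  fixes f g :: "'a::real_normed_vector \<Rightarrow> real"
  assumes "(g has_derivative (\<lambda>h. 0)) (at a)" "g a = 0" "\<And>t. 0 \<le> f t" "\<And>t. f t \<le> g t"
  shows "(f has_derivative (\<lambda>h. 0)) (at a)"
proof -
  have "f a = 0"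
    using assms(2-4) by (metis order_antisym)
  moreover have "((\<lambda>t. norm (g t) / norm (t - a)) \<longlongrightarrow> 0) (at a)"
    using assms(1,2) by (simp add: has_derivative_iff_norm)
  then have "((\<lambda>t. norm (f t) / norm (t - a)) \<longlongrightarrow> 0) (at a)"
  proof (rule Lim_null_comparison[rotated], intro always_eventually allI)
    fix t
    show "norm (norm (f t) / norm (t - a)) \<le> norm (g t) / norm (t - a)"
      using assms(3,4)[of t] by (simp add: divide_right_mono)
  qed
  ultimately show ?thesis
    by (simp add: has_derivative_iff_norm)
qed

text \<open>By the product rule the derivative is 2 f(a) . f'(h), which vanishes with
  \<open>f a\<close>.\<close>

lemma has_derivative_zero_norm_square:
  fixes f :: "'a::real_normed_vector \<Rightarrow> 'b::real_inner"
  assumes "f differentiable (at a)" "f a = 0"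
  shows "((\<lambda>t. (norm (f t))\<^sup>2) has_derivative (\<lambda>h. 0)) (at a)"
proof -
  obtain f' where "(f has_derivative f') (at a)"
    using assms(1) unfolding differentiable_def by blast
  from has_derivative_inner[OF this this] show ?thesis
    by (simp add: assms(2) power2_norm_eq_inner)
qed

text \<open>Riesz representation: \<open>adjoint f' 1\<close> is the vector representing the
  functional \<open>f'\<close>.\<close>

lemma has_derivative_imp_GDERIV:
  fixes f :: "'a::euclidean_space \<Rightarrow> real"
  assumes "(f has_derivative f') (at a)"
  shows "GDERIV f a :> adjoint f' 1"
proof -
  have "f' = (\<lambda>h. h \<bullet> adjoint f' 1)"
    using adjoint_works[OF has_derivative_linear[OF assms], of _ 1] by (auto simp: inner_commute)
  with assms show ?thesis
    by (simp add: gderiv_def)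
qed

theorem proposition3p1:
  fixes \<X> :: "'x set"
    and \<Theta> :: "(real^'N) set"
    and \<phi> :: "real^'N \<Rightarrow> 'x \<Rightarrow> real^'d"
    and x :: "'n::finite \<Rightarrow> 'x"
    and y :: "'n \<Rightarrow> real^'o"
    and \<beta> :: real
    and \<theta> :: "real^'N"
  assumes "open \<Theta>"
    and "\<And>a. a \<in> \<X> \<Longrightarrow> (\<lambda>t. \<phi> t a) differentiable_on \<Theta>"
    and "\<And>i. x i \<in> \<X>"
    and "\<beta> > 0"
    and "\<theta> \<in> \<Theta>"
  shows "\<exists>g. GDERIV (\<lambda>t. loss_star \<phi> x y \<beta> t) \<theta> :> g
           \<and> GDERIV (\<lambda>t. loss \<phi> x y \<beta> (W_star \<phi> x y \<beta> \<theta>) t) \<theta> :> g"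
proof -
  define W where "W = W_star \<phi> x y \<beta> \<theta>"
  let ?G = "half_gradient \<phi> x y \<beta> W"
  have \<phi>: "(\<lambda>t. \<phi> t (x i)) differentiable (at \<theta>)" for i
    using assms by (metis at_within_open differentiable_on_def)
  have G: "?G \<theta> = 0"
    unfolding W_def by (rule half_gradient_W_star[OF \<open>\<beta> > 0\<close>])
  have "?G differentiable (at \<theta>)"
    using \<phi> by (rule differentiable_half_gradient)
  then have "((\<lambda>t. (norm (?G t))\<^sup>2) has_derivative (\<lambda>h. 0)) (at \<theta>)"
    using G by (rule has_derivative_zero_norm_square)
  then have "((\<lambda>t. (norm (?G t))\<^sup>2 / \<beta>) has_derivative (\<lambda>h. 0)) (at \<theta>)"
    by (auto dest: has_derivative_scaleR_right[of _ _ _ "1 / \<beta>"])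
  \<comment> \<open>\<open>W\<close> stays frozen while \<open>t\<close> varies; the gap bounds hold
    for any matrix at every parameter.\<close>
  then have gap: "((\<lambda>t. loss \<phi> x y \<beta> W t - loss_star \<phi> x y \<beta> t) has_derivative (\<lambda>h. 0)) (at \<theta>)"
    by (rule has_derivative_zero_squeeze) (use G loss_gap_bounds[OF \<open>\<beta> > 0\<close>] in auto)
  have "loss \<phi> x y \<beta> W differentiable (at \<theta>)"
    using \<phi> by (rule differentiable_loss)
  then obtain L' where L': "(loss \<phi> x y \<beta> W has_derivative L') (at \<theta>)"
    unfolding differentiable_def by blast
  have "(loss_star \<phi> x y \<beta> has_derivative L') (at \<theta>)"
    using has_derivative_diff[OF L' gap] by simp
  with L' show ?thesis
    unfolding W_def by (blast intro: has_derivative_imp_GDERIV)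
qed

end
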